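(* Let $K\subset\mathbb{R}^p$ be a convex cone, let $\bar A$ be a $p\times p$ symmetric positive semidefinite matrix with largest and second largest eigenvalues $\lambda,\mu$ and eigengap $\nu=\lambda-\mu>0$, and let $\bar x\in K\cap\mathbb{S}^{p-1}$ be a unit eigenvector of $\bar A$ for the eigenvalue $\lambda$. Let $A=\bar A+E$ be symmetric positive semidefinite. Let $v$ be any solution of $$v\in\arg\max_{u\in K\cap\mathbb{S}^{p-1}}u^\top A u .$$ Then $$\|v-\bar x\|\le\sqrt{\frac{4\|E\|_K}{\nu}}\wedge\frac{8\|E\|_{\mathcal{T}_K(\bar x)}}{\nu}\quad\text{if } v^\top\bar x\ge 0,$$ $$\|v+\bar x\|\le\sqrt{\frac{4\|E\|_K}{\nu}}\wedge\frac{8\|E\|_K}{\nu}\quad\text{if } v^\top\bar x\le 0.$$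
   Context: $\|\cdot\|$ is the Euclidean norm, $\mathbb{S}^{p-1}$ the unit sphere of $\mathbb{R}^p$, and $a\wedge b=\min(a,b)$. Eigenvalues are counted with multiplicity. For a cone $C\subset\mathbb{R}^p$ and a $p\times p$ matrix $E$, the cone-restricted operator norm is $\|E\|_C=\sup_{x,y\in C\cap\mathbb{S}^{p-1}}|x^\top E y|$. The tangent cone of $K$ at $\bar x\in K$ is $\mathcal{T}_K(\bar x)=\{t(v-\bar x): t\ge 0,\ v\in K\}$. *)

theory Defs
  imports "HOL-Analysis.Analysis" "HOL-Computational_Algebra.Computational_Algebra"
begin

definition charpoly :: "real ^ 'n ^ 'n \<Rightarrow> real poly" where
  "charpoly A = det (mat [:0, 1:] - (\<chi> i j. [:A $ i $ j:]))"

text \<open>Eigenvalues with multiplicity, in decreasing order. Only real roots of the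
  characteristic polynomial are listed; for a symmetric matrix these are all of its roots,
  and the list has as many entries as the matrix has rows.\<close>

definition eigenvalues :: "real ^ 'n ^ 'n \<Rightarrow> real list" where
  "eigenvalues A = rev (sorted_list_of_multiset (proots (charpoly A)))"

definition symmetric_psd :: "real ^ 'n ^ 'n \<Rightarrow> bool" where
  "symmetric_psd A \<longleftrightarrow> transpose A = A \<and> (\<forall>x. 0 \<le> x \<bullet> (A *v x))"

text \<open>The supremum is over a bounded set. It is an unspecified real when
  \<open>C\<close> contains no unit vector.\<close>

definition cone_norm :: "(real ^ 'n) set \<Rightarrow> real ^ 'n ^ 'n \<Rightarrow> real" where
  "cone_norm C E =
     (SUP (x, y) \<in> (C \<inter> sphere 0 1) \<times> (C \<inter> sphere 0 1). \<bar>x \<bullet> (E *v y)\<bar>)"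

definition tangent_cone :: "'a::real_vector set \<Rightarrow> 'a \<Rightarrow> 'a set" where
  "tangent_cone K x = {t *\<^sub>R (v - x) | t v. 0 \<le> t \<and> v \<in> K}"

end

theory Submission
  imports Defs
begin

unbundle no Formal_Power_Series.fps_syntax

text \<open>
  Maximising the quadratic form of \<open>Abar\<close> over the unit vectors orthogonal to \<open>xbar\<close> produces a
  second eigenvector, so the maximum is a further root of the characteristic polynomial and is at
  most \<open>\<mu>\<close>; no full spectral theorem is needed. With \<open>c = v \<bullet> xbar\<close> this gives the curvature bound
  \<open>\<nu> (1 - c\<^sup>2) \<le> lam - v \<bullet> Abar v\<close>, and optimality of \<open>v\<close> bounds the right-hand side by
  \<open>v \<bullet> E v - xbar \<bullet> E xbar = (v - xbar) \<bullet> E (v + xbar)\<close>. Estimating the two terms separately yields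
  the square-root rate, estimating the product yields the linear rate: \<open>v - xbar\<close> and \<open>v + xbar\<close> both
  lie in the tangent cone, while for \<open>c \<le> 0\<close> one writes \<open>v - xbar = (v + xbar) - 2 xbar\<close> to stay
  inside \<open>K\<close>.
\<close>

section \<open>The characteristic polynomial\<close>

lemma poly_det: "poly (det M) t = det (\<chi> i j. poly (M $ i $ j) t)"
  for M :: "'a::comm_ring_1 poly ^ 'n ^ 'n"
  by (simp add: det_def poly_sum poly_prod)

lemma poly_charpoly: "poly (charpoly A) t = det (mat t - A)"
proof -
  have "(\<chi> i j. poly ((mat [:0, 1:] - (\<chi> i j. [:A $ i $ j:])) $ i $ j) t) = mat t - A"
    by (simp add: vec_eq_iff mat_def)
  then show ?thesis
    by (simp add: charpoly_def poly_det)
qed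

lemma det_const_poly: "det (\<chi> i j. [:P $ i $ j:]) = [:det P:]"
  for P :: "real ^ 'n ^ 'n"
proof -
  have "(\<chi> i j. poly ((\<chi> i j. [:P $ i $ j:]) $ i $ j) t) = P" for t
    by (simp add: vec_eq_iff)
  then have "poly (det (\<chi> i j. [:P $ i $ j:])) = poly [:det P:]"
    by (auto simp: poly_det)
  then show ?thesis
    by (simp only: poly_eq_poly_eq_iff)
qed

text \<open>A root would give an eigenvector stretched by more than the operator norm once
  \<open>t\<close> exceeds \<open>onorm\<close>, so the value at such a \<open>t\<close> is nonzero.
  This licenses \<open>proots_mult\<close> for factorisations of \<open>charpoly A\<close>.\<close>

lemma charpoly_nonzero: "charpoly A \<noteq> 0"
proof
  assume 0: "charpoly A = 0"
  define t where "t = onorm ((*v) A) + 1"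
  have "det (mat t - A) = 0"
    using 0 by (metis poly_charpoly poly_0)
  then obtain z where z: "z \<noteq> 0" "(mat t - A) *v z = 0"
    by (metis matrix_left_invertible_ker invertible_det_nz invertible_left_inverse)
  have "mat t *v z = t *\<^sub>R z"
    by (simp add: vec_eq_iff mat_def matrix_vector_mult_def if_distrib [of "\<lambda>x. x * _"] cong: if_cong)
  with z have "A *v z = t *\<^sub>R z"
    by (simp add: matrix_vector_mult_diff_rdistrib)
  moreover have "norm (A *v z) \<le> onorm ((*v) A) * norm z"
    by (simp add: onorm)
  moreover have "0 \<le> onorm ((*v) A)"
    by (simp add: onorm_pos_le)
  ultimately show False
    using z by (simp add: t_def)
qed

text \<open>Extend the pair to a basis and use the basis vectors as rows. The result serves as a
  change of basis that isolates two eigenvectors.\<close>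

lemma invertible_matrix_with_rows:
  fixes x y :: "real ^ 'n"
  assumes "independent {x, y}" "x \<noteq> y"
  obtains P :: "real ^ 'n ^ 'n" and i j where "det P \<noteq> 0" "i \<noteq> j" "P $ i = x" "P $ j = y"
proof -
  obtain B where B: "{x, y} \<subseteq> B" "independent B" "UNIV \<subseteq> span B"
    using maximal_independent_subset_extend [OF subset_UNIV assms(1)] by metis
  then have "dim (UNIV :: (real ^ 'n) set) = card B"
    by (intro basis_card_eq_dim [symmetric]) auto
  then have "card B = card (UNIV :: 'n set)"
    by (simp add: dim_UNIV)
  moreover have "finite B"
    using B(2) by (rule independent_imp_finite)
  ultimately obtain f where f: "bij_betw f (UNIV :: 'n set) B"
    using finite_same_card_bij [of "UNIV :: 'n set" B] by auto
  define P where "P = (\<chi> i. f i)"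
  have "rows P = B"
    using f by (auto simp: rows_def row_def P_def bij_betw_def)
  then have "det P \<noteq> 0"
    using B(3) matrix_left_invertible_span_rows [of P]
    by (simp add: top.extremum_unique invertible_det_nz [symmetric] invertible_left_inverse)
  moreover have "x \<in> range f" "y \<in> range f"
    using f B(1) by (auto simp: bij_betw_def)
  then obtain i j where "f i = x" "f j = y"
    by blast
  ultimately show thesis
    using that [of P i j] assms(2) by (auto simp: P_def)
qed

lemma symmetric_inner_mult:
  fixes A :: "real ^ 'n ^ 'n"
  assumes "transpose A = A"
  shows "x \<bullet> (A *v y) = y \<bullet> (A *v x)"
  using dot_lmul_matrix [of x A y] vector_transpose_matrix [of x A] assms
  by (simp add: inner_commute)

text \<open>In a basis containing both eigenvectors, two rows of the characteristic matrix are
  divisible by the linear factors, which can be pulled out of the determinant. Independence makes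
  this count multiplicity: for \<open>a = b\<close> it yields a double root.\<close>

lemma two_eigenvectors_dvd_charpoly:
  assumes sym: "transpose A = A"
    and x: "A *v x = a *\<^sub>R x" and y: "A *v y = b *\<^sub>R y"
    and indep: "independent {x, y}" "x \<noteq> y"
  shows "[:- a, 1:] * [:- b, 1:] dvd charpoly A"
proof -
  obtain P i j where P: "det P \<noteq> 0" "i \<noteq> j" "P $ i = x" "P $ j = y"
    using invertible_matrix_with_rows indep by metis
  define M where "M = mat [:0, 1:] - (\<chi> i j. [:A $ i $ j:])"
  define P' where "P' = (\<chi> i j. [:P $ i $ j:])"
  define d where "d = (\<lambda>k. if k = i then [:- a, 1:] else if k = j then [:- b, 1:] else 1)"
  \<comment> \<open>\<open>Q\<close> is \<open>P' ** M\<close> with the factors of rows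
    \<open>i\<close> and \<open>j\<close> divided out; \<open>D\<close> puts them back.\<close>
  define Q where "Q = (\<chi> k. if k = i \<or> k = j then P' $ k else (P' ** M) $ k)"
  define D where "D = (\<chi> k l. if k = l then d k else 0)"
  have eigen_row: "(P' ** M) $ k $ l = [:- c, 1:] * P' $ k $ l" if "A *v (P $ k) = c *\<^sub>R P $ k" for k l c
  proof -
    \<comment> \<open>Symmetry turns a right eigenvector into a left one, which is what row
      \<open>k\<close> of a product on the left requires.\<close>
    have "P $ k v* A = c *\<^sub>R P $ k"
      using sym that by (metis vector_transpose_matrix)
    then have "(\<Sum>m\<in>UNIV. P $ k $ m * A $ m $ l) = c * P $ k $ l"
      by (simp add: vec_eq_iff vector_matrix_mult_def mult.commute)
    \<comment> \<open>A real polynomial is determined by its values, so the row identity is checked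
      pointwise.\<close>
    moreover have "poly ((P' ** M) $ k $ l) t = t * P $ k $ l - (\<Sum>m\<in>UNIV. P $ k $ m * A $ m $ l)" for t
      by (simp add: matrix_matrix_mult_def P'_def M_def poly_sum mat_def right_diff_distrib
          sum_subtractf if_distrib [of "\<lambda>p. poly p t"] if_distrib [of "\<lambda>x. _ * x"] mult.commute cong: if_cong)
    ultimately have "poly ((P' ** M) $ k $ l) = poly ([:- c, 1:] * P' $ k $ l)"
      by (auto simp: P'_def algebra_simps)
    then show ?thesis
      by (simp only: poly_eq_poly_eq_iff)
  qed
  have "P' ** M = D ** Q"
  proof -
    have "(D ** Q) $ k $ l = d k * Q $ k $ l" for k l
      by (simp add: matrix_matrix_mult_def D_def if_distrib [of "\<lambda>x. x * _"] cong: if_cong)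
    then show ?thesis
      using eigen_row [of i a] eigen_row [of j b] P x y
      by (auto simp: vec_eq_iff d_def Q_def)
  qed
  then have "det P' * charpoly A = det D * det Q"
    by (metis M_def charpoly_def det_mul)
  moreover have "det D = [:- a, 1:] * [:- b, 1:]"
  proof -
    have "det D = (\<Prod>k\<in>UNIV. d k)"
      by (subst det_diagonal) (auto simp: D_def)
    also have "\<dots> = (\<Prod>k\<in>{i, j}. d k)"
      by (rule prod.mono_neutral_right) (auto simp: d_def)
    finally show ?thesis
      using P by (simp add: d_def)
  qed
  moreover have "det P' = [:det P:]"
    by (simp add: P'_def det_const_poly)
  ultimately have "smult (det P) (charpoly A) = [:- a, 1:] * [:- b, 1:] * det Q"
    by simp
  then show ?thesis
    using P by (metis dvd_smult_iff dvd_triv_left)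
qed

text \<open>Removing one copy of the top eigenvalue \<open>a\<close> still leaves \<open>b\<close>
  in the tail, even if \<open>b = a\<close>, and the head of the decreasing tail is its
  maximum.\<close>

lemma eigenvalues_second_ge:
  assumes "transpose A = A" "A *v x = a *\<^sub>R x" "A *v y = b *\<^sub>R y" "independent {x, y}" "x \<noteq> y"
    and top: "a = eigenvalues A ! 0"
  shows "b \<le> eigenvalues A ! 1"
proof -
  obtain q where q: "charpoly A = [:- a, 1:] * [:- b, 1:] * q"
    using two_eigenvectors_dvd_charpoly assms by blast
  with charpoly_nonzero [of A] have "q \<noteq> 0"
    by auto
  then have "proots (charpoly A) = {#a#} + {#b#} + proots q"
    unfolding q by (subst proots_mult; simp add: proots_mult del: mult_pCons_left mult_pCons_right)+
  then have mset: "mset (eigenvalues A) = add_mset a (add_mset b (proots q))"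
    by (simp add: eigenvalues_def)
  then obtain w ws where ws: "eigenvalues A = w # ws"
    by (cases "eigenvalues A") auto
  then have "mset ws = add_mset b (proots q)"
    using mset top by simp
  then obtain u us where us: "ws = u # us"
    by (cases ws) auto
  have "sorted (rev (eigenvalues A))"
    by (simp add: eigenvalues_def)
  then have "\<forall>z\<in>set ws. z \<le> u"
    using ws us by (auto simp: sorted_append)
  moreover have "b \<in> set ws"
    using \<open>mset ws = _\<close> by (metis set_mset_mset union_single_eq_member)
  ultimately show ?thesis
    using ws us by auto
qed

section \<open>The quadratic form orthogonally to an eigenvector\<close>

lemma linear_coeff_zero_if_nonneg:
  fixes a b :: real
  assumes "\<And>s. 0 \<le> 2 * s * a + s\<^sup>2 * b"
  shows "a = 0"
proof (rule ccontr)
  assume "a \<noteq> 0"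
  \<comment> \<open>With \<open>s = - a / k\<close> and \<open>k\<close> above both \<open>0\<close>
    and \<open>b\<close>, the negative linear term outweighs the quadratic one.\<close>
  define k where "k = \<bar>b\<bar> + 1"
  have k: "0 < k" "b < k"
    by (auto simp: k_def)
  have "0 \<le> 2 * (- a / k) * a + (- a / k)\<^sup>2 * b"
    by (rule assms)
  also have "\<dots> = a\<^sup>2 / k\<^sup>2 * (b - 2 * k)"
    using k by (simp add: field_simps power2_eq_square)
  also have "\<dots> < 0"
    using k \<open>a \<noteq> 0\<close> by (intro mult_pos_neg) auto
  finally show False
    by simp
qed

lemma second_eigenvector_exists:
  fixes A :: "real ^ 'n ^ 'n"
  assumes card: "CARD('n) \<ge> 2" and sym: "transpose A = A" and x: "A *v x = a *\<^sub>R x"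
  obtains y m where "norm y = 1" "x \<bullet> y = 0" "A *v y = m *\<^sub>R y"
    "\<And>w. x \<bullet> w = 0 \<Longrightarrow> w \<bullet> (A *v w) \<le> m * (norm w)\<^sup>2"
proof -
  define S where "S = sphere 0 1 \<inter> {u. x \<bullet> u = 0}"
  \<comment> \<open>Dimension at least two makes \<open>S\<close> nonempty, so a maximiser
    exists.\<close>
  obtain z where "z \<noteq> 0" "orthogonal x z"
    using orthogonal_to_vector_exists [of x] card by auto
  then have "z /\<^sub>R norm z \<in> S"
    by (auto simp: S_def orthogonal_def)
  moreover have "compact S"
    unfolding S_def by (intro compact_Int_closed closed_hyperplane) auto
  moreover have "continuous_on S (\<lambda>u. u \<bullet> (A *v u))"
    by (intro continuous_on_inner continuous_on_id linear_continuous_on matrix_vector_mul_bounded_linear)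
  ultimately obtain y where y: "y \<in> S" and max: "\<And>u. u \<in> S \<Longrightarrow> u \<bullet> (A *v u) \<le> y \<bullet> (A *v y)"
    using continuous_attains_sup [of S "\<lambda>u. u \<bullet> (A *v u)"] by blast
  define m where "m = y \<bullet> (A *v y)"
  have y1: "norm y = 1" "x \<bullet> y = 0"
    using y by (auto simp: S_def)
  \<comment> \<open>Homogeneity removes the normalisation, so perturbations of \<open>y\<close> can
    be compared without rescaling.\<close>
  have bound: "w \<bullet> (A *v w) \<le> m * (norm w)\<^sup>2" if w: "x \<bullet> w = 0" for w
  proof (cases "w = 0")
    case False
    then have "w /\<^sub>R norm w \<in> S"
      using w by (auto simp: S_def)
    from max [OF this] have "(w \<bullet> (A *v w)) / (norm w)\<^sup>2 \<le> m"
      by (simp add: m_def matrix_vector_mult_scaleR power2_eq_square divide_simps)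
    then show ?thesis
      using False by (simp add: divide_le_eq)
  qed auto
  text \<open>The residual \<open>r\<close> of \<open>y\<close> is itself orthogonal to \<open>x\<close>, so it is an admissible perturbation.\<close>
  define r where "r = m *\<^sub>R y - A *v y"
  have "x \<bullet> (A *v y) = 0"
    using symmetric_inner_mult [OF sym, of x y] x y1 by (simp add: inner_commute)
  then have xr: "x \<bullet> r = 0"
    using y1 by (simp add: r_def inner_diff_right)
  \<comment> \<open>Expand \<open>bound\<close> at \<open>y + s r\<close>: the constant terms
    cancel, and the linear coefficient is the squared length of the residual, which must therefore
    vanish.\<close>
  have "0 \<le> 2 * s * (r \<bullet> r) + s\<^sup>2 * (m * (norm r)\<^sup>2 - r \<bullet> (A *v r))" for s
  proof -
    have "(y + s *\<^sub>R r) \<bullet> (A *v (y + s *\<^sub>R r)) \<le> m * (norm (y + s *\<^sub>R r))\<^sup>2"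
      by (rule bound) (simp add: inner_add_right y1 xr)
    moreover have "(norm (y + s *\<^sub>R r))\<^sup>2 = 1 + 2 * s * (r \<bullet> y) + s\<^sup>2 * (norm r)\<^sup>2"
      using y1 by (simp add: power2_norm_eq_inner inner_add_left inner_add_right inner_commute
          norm_eq_1 power2_eq_square [of s] algebra_simps)
    moreover have "(y + s *\<^sub>R r) \<bullet> (A *v (y + s *\<^sub>R r)) =
        m + 2 * s * (r \<bullet> (A *v y)) + s\<^sup>2 * (r \<bullet> (A *v r))"
      using symmetric_inner_mult [OF sym, of y r]
      by (simp add: matrix_vector_right_distrib matrix_vector_mult_scaleR inner_add_left
          inner_add_right m_def power2_eq_square algebra_simps)
    moreover have "r \<bullet> r = m * (r \<bullet> y) - r \<bullet> (A *v y)"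
      by (subst (2) r_def) (simp add: inner_diff_right)
    ultimately show ?thesis
      by (simp only:) (simp add: algebra_simps)
  qed
  then have "r = 0"
    using linear_coeff_zero_if_nonneg by fastforce
  then show thesis
    using that [of y m] y1 bound by (simp add: r_def)
qed

text \<open>Split \<open>v\<close> into its component along \<open>x\<close> and an orthogonal
  remainder \<open>w\<close> with squared length \<open>1 - c\<^sup>2\<close>. The cross terms
  vanish because \<open>x\<close> is an eigenvector, and \<open>w\<close> contributes at most the
  second eigenvalue times that squared length.\<close>

lemma quadratic_form_eigengap:
  fixes A :: "real ^ 'n ^ 'n"
  assumes card: "CARD('n) \<ge> 2" and sym: "transpose A = A"
    and x: "norm x = 1" "A *v x = (eigenvalues A ! 0) *\<^sub>R x"
    and v: "norm v = 1"
  shows "(eigenvalues A ! 0 - eigenvalues A ! 1) * (1 - (v \<bullet> x)\<^sup>2)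
    \<le> eigenvalues A ! 0 - v \<bullet> (A *v v)"
proof -
  define a where "a = eigenvalues A ! 0"
  have xa: "A *v x = a *\<^sub>R x"
    using x by (simp add: a_def)
  obtain y m where y: "norm y = 1" "x \<bullet> y = 0" "A *v y = m *\<^sub>R y"
    and bound: "\<And>w. x \<bullet> w = 0 \<Longrightarrow> w \<bullet> (A *v w) \<le> m * (norm w)\<^sup>2"
    using second_eigenvector_exists [OF card sym xa] by metis
  have "x \<noteq> y"
    using x y by (metis inner_eq_zero_iff norm_zero zero_neq_one)
  moreover have "independent {x, y}"
    using x y by (intro pairwise_orthogonal_independent)
      (auto simp: pairwise_def orthogonal_def inner_commute)
  ultimately have m: "m \<le> eigenvalues A ! 1"
    using eigenvalues_second_ge [OF sym xa] y a_def by blast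
  define c where "c = v \<bullet> x"
  define w where "w = v - c *\<^sub>R x"
  have xx: "x \<bullet> x = 1" and vv: "v \<bullet> v = 1"
    using x v by (simp_all add: norm_eq_1)
  have xw: "x \<bullet> w = 0"
    by (simp add: w_def c_def inner_diff_right inner_commute xx)
  have nw: "(norm w)\<^sup>2 = 1 - c\<^sup>2"
    by (simp add: power2_norm_eq_inner w_def inner_diff_left inner_diff_right vv xx
        inner_commute [of x v] c_def [symmetric] power2_eq_square [of c])
  have v_eq: "v = c *\<^sub>R x + w"
    by (simp add: w_def)
  have "x \<bullet> (A *v w) = 0"
    using symmetric_inner_mult [OF sym, of x w] xa xw by (simp add: inner_commute)
  then have "v \<bullet> (A *v v) = a * c\<^sup>2 + w \<bullet> (A *v w)"
    using xw xx by (simp add: v_eq matrix_vector_right_distrib matrix_vector_mult_scaleR xa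
        inner_add_left inner_add_right inner_commute [of w x] power2_eq_square)
  also have "\<dots> \<le> a * c\<^sup>2 + (eigenvalues A ! 1) * (1 - c\<^sup>2)"
    using bound [OF xw] mult_right_mono [OF m, of "1 - c\<^sup>2"] nw
    by (metis add_left_mono order_trans zero_le_power2)
  finally show ?thesis
    by (simp add: a_def c_def algebra_simps)
qed

section \<open>Cone-restricted operator norm\<close>

text \<open>Normalise both vectors and scale back. Closure under nonnegative scaling is all that is
  asked of \<open>C\<close>, so the bound serves \<open>K\<close> and its tangent cone
  alike.\<close>

lemma abs_inner_le_cone_norm:
  fixes C :: "(real ^ 'n) set"
  assumes C: "\<And>t u. u \<in> C \<Longrightarrow> 0 \<le> t \<Longrightarrow> t *\<^sub>R u \<in> C" and xy: "x \<in> C" "y \<in> C"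
  shows "\<bar>x \<bullet> (E *v y)\<bar> \<le> cone_norm C E * norm x * norm y"
proof (cases "x = 0 \<or> y = 0")
  case False
  \<comment> \<open>A real \<open>SUP\<close> dominates its family only once boundedness is
    known.\<close>
  have "bdd_above ((\<lambda>(x, y). \<bar>x \<bullet> (E *v y)\<bar>) ` ((C \<inter> sphere 0 1) \<times> (C \<inter> sphere 0 1)))"
  proof (rule bdd_aboveI2 [where M = "onorm ((*v) E)"], clarsimp)
    fix a b :: "real ^ 'n"
    assume "norm a = 1" "norm b = 1"
    then show "\<bar>a \<bullet> (E *v b)\<bar> \<le> onorm ((*v) E)"
      using Cauchy_Schwarz_ineq2 [of a "E *v b"] onorm [of "(*v) E" b] by simp
  qed
  moreover have "(x /\<^sub>R norm x, y /\<^sub>R norm y) \<in> (C \<inter> sphere 0 1) \<times> (C \<inter> sphere 0 1)"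
    using False C xy by simp
  ultimately have "\<bar>(x /\<^sub>R norm x) \<bullet> (E *v (y /\<^sub>R norm y))\<bar> \<le> cone_norm C E"
    unfolding cone_norm_def by (metis (no_types, lifting) cSUP_upper case_prod_conv)
  then show ?thesis
    using False by (simp add: matrix_vector_mult_scaleR abs_mult field_simps)
qed auto

text \<open>The unit vector \<open>x\<close> rules out a supremum over the empty set, whose value is
  unspecified.\<close>

lemma cone_norm_nonneg:
  assumes "\<And>t u. u \<in> C \<Longrightarrow> 0 \<le> t \<Longrightarrow> t *\<^sub>R u \<in> C" "x \<in> C" "norm x = 1"
  shows "0 \<le> cone_norm C E"
  using abs_inner_le_cone_norm [OF assms(1) assms(2) assms(2), of E] assms(3) by simp

lemma tangent_cone_scaleR:
  assumes "u \<in> tangent_cone K x" "0 \<le> t"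
  shows "t *\<^sub>R u \<in> tangent_cone K x"
proof -
  obtain s w where "u = s *\<^sub>R (w - x)" "0 \<le> s" "w \<in> K"
    using assms(1) by (auto simp: tangent_cone_def)
  then have "t *\<^sub>R u = (t * s) *\<^sub>R (w - x) \<and> 0 \<le> t * s \<and> w \<in> K"
    using assms(2) by simp
  then show ?thesis
    unfolding tangent_cone_def by blast
qed

lemma diff_in_tangent_cone: "u \<in> K \<Longrightarrow> u - x \<in> tangent_cone K x"
  unfolding tangent_cone_def by (rule CollectI, intro exI [of _ 1] exI [of _ u]) simp

text \<open>A convex cone is closed under addition, so \<open>u\<close> is the direction from
  \<open>x\<close> to the point \<open>u + x\<close> of \<open>K\<close>.\<close>

lemma convex_cone_subset_tangent_cone:
  assumes "convex_cone K" "x \<in> K"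
  shows "K \<subseteq> tangent_cone K x"
proof
  fix u assume "u \<in> K"
  then have "u + x - x \<in> tangent_cone K x"
    using assms by (intro diff_in_tangent_cone convex_cone_add)
  then show "u \<in> tangent_cone K x"
    by simp
qed

section \<open>Perturbation bounds for the cone-constrained maximiser\<close>

theorem theorem3p1:
  fixes K :: "(real ^ 'n) set"
    and Abar A E :: "real ^ 'n ^ 'n"
    and xbar v :: "real ^ 'n"
    and lam \<mu> \<nu> :: real
  assumes "CARD('n) \<ge> 2"
    and "convex_cone K"
    and "symmetric_psd Abar"
    and "lam = eigenvalues Abar ! 0"
    and "\<mu> = eigenvalues Abar ! 1"
    and "\<nu> = lam - \<mu>"
    and "\<nu> > 0"
    and "xbar \<in> K \<inter> sphere 0 1"
    and "Abar *v xbar = lam *\<^sub>R xbar"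
    and "A = Abar + E"
    and "symmetric_psd A"
    and "is_arg_max (\<lambda>u. u \<bullet> (A *v u)) (\<lambda>u. u \<in> K \<inter> sphere 0 1) v"
  shows "(v \<bullet> xbar \<ge> 0 \<longrightarrow>
            norm (v - xbar) \<le>
              min (sqrt (4 * cone_norm K E / \<nu>)) (8 * cone_norm (tangent_cone K xbar) E / \<nu>)) \<and>
         (v \<bullet> xbar \<le> 0 \<longrightarrow>
            norm (v + xbar) \<le>
              min (sqrt (4 * cone_norm K E / \<nu>)) (8 * cone_norm K E / \<nu>))"
proof -
  define c where "c = v \<bullet> xbar"
  define T where "T = tangent_cone K xbar"
  have xK: "xbar \<in> K" and x1: "norm xbar = 1"
    using assms(8) by auto
  have vK: "v \<in> K" and v1: "norm v = 1"
    using assms(12) by (auto simp: is_arg_max_def)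
  have opt: "xbar \<bullet> (A *v xbar) \<le> v \<bullet> (A *v v)"
    using assms(8,12) by (auto simp: is_arg_max_linorder)
  have K_scale: "\<And>t u. u \<in> K \<Longrightarrow> 0 \<le> t \<Longrightarrow> t *\<^sub>R u \<in> K"
    using assms(2) by (simp add: convex_cone_scaleR)
  have E_eq: "E *v u = A *v u - Abar *v u" for u
    by (simp add: assms(10) matrix_vector_mult_add_rdistrib)
  have E_sym: "v \<bullet> (E *v xbar) = xbar \<bullet> (E *v v)"
    using assms(3,11) symmetric_inner_mult [of A v xbar] symmetric_inner_mult [of Abar v xbar]
    by (simp add: E_eq inner_diff_right symmetric_psd_def)
  have E_diff: "v \<bullet> (E *v v) - xbar \<bullet> (E *v xbar) = (v - xbar) \<bullet> (E *v (v + xbar))"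
    using E_sym by (simp add: matrix_vector_right_distrib inner_diff_left inner_add_right)
  have "\<nu> * (1 - c\<^sup>2) \<le> lam - v \<bullet> (Abar *v v)"
    using quadratic_form_eigengap [OF assms(1), of Abar xbar v] assms(3-6,9) x1 v1
    by (simp add: symmetric_psd_def c_def)
  also have "\<dots> \<le> v \<bullet> (E *v v) - xbar \<bullet> (E *v xbar)"
    using opt x1 by (simp add: E_eq inner_diff_right assms(9) norm_eq_1)
  finally have main: "\<nu> * (1 - c\<^sup>2) \<le> v \<bullet> (E *v v) - xbar \<bullet> (E *v xbar)" .
  have norm_diff: "(norm (v - xbar))\<^sup>2 = 2 - 2 * c" and norm_sum: "(norm (v + xbar))\<^sup>2 = 2 + 2 * c"
    using v1 x1 by (simp_all add: power2_norm_eq_inner norm_eq_1 inner_diff_left inner_diff_right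
        inner_add_left inner_add_right inner_commute [of xbar v] c_def)
  have c1: "\<bar>c\<bar> \<le> 1"
    using Cauchy_Schwarz_ineq2 [of v xbar] v1 x1 by (simp add: c_def)
  \<comment> \<open>Here \<open>d\<close> stands for either distance. The two quadratic terms in
    \<open>main\<close> are each at most \<open>cone_norm K E\<close> in modulus, and the factor 2
    in the premise makes the constant 4.\<close>
  have sqrt_bound: "d \<le> sqrt (4 * cone_norm K E / \<nu>)"
    if "d\<^sup>2 \<le> 2 * (1 - c\<^sup>2)" for d
  proof (rule real_le_rsqrt)
    have "\<nu> * d\<^sup>2 \<le> 2 * (\<nu> * (1 - c\<^sup>2))"
      using that assms(7) by simp
    also have "\<dots> \<le> 2 * (2 * cone_norm K E)"
      using main abs_inner_le_cone_norm [OF K_scale vK vK, of E]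
        abs_inner_le_cone_norm [OF K_scale xK xK, of E] v1 x1 by simp
    finally show "d\<^sup>2 \<le> 4 * cone_norm K E / \<nu>"
      using assms(7) by (simp add: field_simps)
  qed
  \<comment> \<open>The perturbation term now carries a factor \<open>d\<close>, so one power of
    \<open>d\<close> cancels; the constant 8 is 2 times 4. The case \<open>d = 0\<close> is separate
    because of the division.\<close>
  have linear_bound: "d \<le> 8 * N / \<nu>"
    if "d\<^sup>2 \<le> 2 * (1 - c\<^sup>2)" "v \<bullet> (E *v v) - xbar \<bullet> (E *v xbar) \<le> 4 * N * d" "0 \<le> d" "0 \<le> N" for d N
  proof (cases "d = 0")
    case False
    have "\<nu> * d\<^sup>2 \<le> 2 * (\<nu> * (1 - c\<^sup>2))"
      using that assms(7) by simp
    also have "\<dots> \<le> 8 * N * d"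
      using main that by simp
    finally have "(\<nu> * d) * d \<le> (8 * N) * d"
      by (simp add: power2_eq_square)
    then have "\<nu> * d \<le> 8 * N"
      using False that by (simp add: mult_le_cancel_right)
    then show ?thesis
      using assms(7) by (simp add: field_simps)
  qed (use that assms(7) in simp)
  show ?thesis
    unfolding c_def [symmetric] T_def [symmetric]
  proof (intro conjI impI)
    assume c: "0 \<le> c"
    \<comment> \<open>For \<open>c\<close> between 0 and 1, \<open>c\<^sup>2\<close> is at most
      \<open>c\<close>.\<close>
    have sq: "(norm (v - xbar))\<^sup>2 \<le> 2 * (1 - c\<^sup>2)"
      using mult_left_mono [of c 1 c] c c1 by (simp add: norm_diff power2_eq_square [of c])
    have T_scale: "\<And>t u. u \<in> T \<Longrightarrow> 0 \<le> t \<Longrightarrow> t *\<^sub>R u \<in> T"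
      by (simp add: T_def tangent_cone_scaleR)
    have KT: "K \<subseteq> T"
      using convex_cone_subset_tangent_cone [OF assms(2) xK] by (simp add: T_def)
    have N: "0 \<le> cone_norm T E"
      using cone_norm_nonneg [OF T_scale _ x1] KT xK by blast
    have "v - xbar \<in> T" "v + xbar \<in> T"
      using diff_in_tangent_cone [OF vK] KT convex_cone_add [OF assms(2) vK xK]
      by (auto simp: T_def)
    then have "(v - xbar) \<bullet> (E *v (v + xbar)) \<le> cone_norm T E * norm (v - xbar) * norm (v + xbar)"
      using abs_inner_le_cone_norm [OF T_scale, of "v - xbar" "v + xbar" E] by linarith
    \<comment> \<open>The triangle inequality gives 2; the weaker 4 matches the premise of
      \<open>linear_bound\<close> shared by both signs of \<open>c\<close>.\<close>
    also have "\<dots> \<le> cone_norm T E * norm (v - xbar) * 4"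
      using norm_triangle_ineq [of v xbar] v1 x1 N by (intro mult_left_mono) auto
    finally have "norm (v - xbar) \<le> 8 * cone_norm T E / \<nu>"
      using sq N by (intro linear_bound) (auto simp: E_diff)
    then show "norm (v - xbar) \<le> min (sqrt (4 * cone_norm K E / \<nu>)) (8 * cone_norm T E / \<nu>)"
      using sqrt_bound [OF sq] by simp
  next
    assume c: "c \<le> 0"
    \<comment> \<open>For \<open>c\<close> between -1 and 0, \<open>c\<^sup>2\<close> is at most
      \<open>- c\<close>.\<close>
    have sq: "(norm (v + xbar))\<^sup>2 \<le> 2 * (1 - c\<^sup>2)"
      using mult_left_mono [of "- c" 1 "- c"] c c1 by (simp add: norm_sum power2_eq_square [of c])
    have N: "0 \<le> cone_norm K E"
      using cone_norm_nonneg [OF K_scale xK x1] .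
    define s where "s = v + xbar"
    have sK: "s \<in> K"
      using convex_cone_add [OF assms(2) vK xK] by (simp add: s_def)
    have s2: "norm s \<le> 2"
      using norm_triangle_ineq [of v xbar] v1 x1 by (simp add: s_def)
    have "(v - xbar) \<bullet> (E *v s) = s \<bullet> (E *v s) - 2 * (xbar \<bullet> (E *v s))"
      by (simp add: s_def inner_add_left inner_diff_left)
    also have "\<dots> \<le> cone_norm K E * norm s * norm s + 2 * (cone_norm K E * norm s)"
      using abs_inner_le_cone_norm [OF K_scale sK sK, of E]
        abs_inner_le_cone_norm [OF K_scale xK sK, of E] x1 by simp
    \<comment> \<open>One factor \<open>norm s\<close> is replaced by 2 and the other is kept, so
      the total is exactly the 4 of \<open>linear_bound\<close>.\<close>
    also have "\<dots> \<le> cone_norm K E * norm s * 2 + 2 * (cone_norm K E * norm s)"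
      using s2 N by (intro add_right_mono mult_left_mono) auto
    finally have "norm s \<le> 8 * cone_norm K E / \<nu>"
      using sq N by (intro linear_bound) (auto simp: E_diff s_def)
    then show "norm (v + xbar) \<le> min (sqrt (4 * cone_norm K E / \<nu>)) (8 * cone_norm K E / \<nu>)"
      using sqrt_bound [OF sq] by (simp add: s_def)
  qed
qed

end
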